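(* Let $X$ be a random variable with values in $\{0,1,2,\dots\}$, $p_i=P(X=i)$, and probability generating function $P(s)=\sum_{i\ge 0}p_i s^i$ for real $s$ with $|s|\le 1$. Then $X$ obeys a stuttering Poisson distribution if and only if $P(s)>0$ for all $|s|\le 1$ and the logarithm of $P$ has a power series expansion $$\ln P(s)=\sum_{i=0}^{r} b_i s^i,\qquad |s|\le 1,$$ for some $r\in\{1,2,\dots\}\cup\{\infty\}$ and real numbers $b_i$ with $b_i\ge 0$ for all $i\ge 1$ and $\sum_{i=1}^{r} b_i=\lambda$ for some $0<\lambda<\infty$.
   Context: A random variable $X$ with values in $\{0,1,2,\dots\}$ obeys a stuttering Poisson distribution (SPD) if there exist $r\in\{1,2,\dots\}\cup\{\infty\}$, a real number $\lambda>0$, and real numbers $\alpha_i$ with $0\le\alpha_i\le 1$ for $1\le i\le r$ (respectively for all $i\ge1$ if $r=\infty$) and $\sum_{i=1}^{r}\alpha_i=1$, with $\alpha_r\neq0$ when $r<\infty$, such that the probability generating function of $X$ is $$E(s^X)=\exp\Big(\lambda\sum_{i=1}^{r}\alpha_i(s^i-1)\Big),\qquad |s|\le 1.$$ *)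

theory Defs
  imports "HOL-Probability.Probability" "HOL-Library.Extended_Nat"
begin

definition pgf :: "'a measure \<Rightarrow> ('a \<Rightarrow> nat) \<Rightarrow> real \<Rightarrow> real" where
  "pgf M X s = (\<Sum>i. measure M {\<omega> \<in> space M. X \<omega> = i} * s ^ i)"

text \<open>
  The upper summation bound \<open>r\<close> is a positive integer or infinity, hence of type \<^typ>\<open>enat\<close>.
  A sum over \<open>1 \<le> i \<le> r\<close> is written as an ordinary series whose terms outside that range are
  zero; the values of \<open>\<alpha>\<close> outside that range are irrelevant.  The series in the exponent
  converges absolutely for \<open>\<bar>s\<bar> \<le> 1\<close>, because the \<open>\<alpha> i\<close> are nonnegative with sum 1.
\<close>
definition stuttering_Poisson :: "'a measure \<Rightarrow> ('a \<Rightarrow> nat) \<Rightarrow> bool" where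
  "stuttering_Poisson M X \<longleftrightarrow>
    (\<exists>(r :: enat) (lam :: real) (\<alpha> :: nat \<Rightarrow> real).
       1 \<le> r \<and> 0 < lam \<and>
       (\<forall>i. 1 \<le> i \<and> enat i \<le> r \<longrightarrow> 0 \<le> \<alpha> i \<and> \<alpha> i \<le> 1) \<and>
       (\<lambda>i. if 1 \<le> i \<and> enat i \<le> r then \<alpha> i else 0) sums 1 \<and>
       (\<forall>n. r = enat n \<longrightarrow> \<alpha> n \<noteq> 0) \<and>
       (\<forall>s :: real. \<bar>s\<bar> \<le> 1 \<longrightarrow>
          prob_space.expectation M (\<lambda>\<omega>. s ^ X \<omega>) =
          exp (lam * (\<Sum>i. if 1 \<le> i \<and> enat i \<le> r then \<alpha> i * (s ^ i - 1) else 0))))"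

end

theory Submission
  imports Defs
begin

text \<open>
  Since \<open>P 1 = 1\<close>, the coefficients of \<open>ln P\<close> sum to \<open>0\<close>, which forces \<open>b 0 = - \<lambda>\<close>; hence
  \<open>ln P s = \<Sum>i\<ge>1. b i * (s ^ i - 1)\<close>, and the two representations correspond under
  \<open>b i = \<lambda> * \<alpha> i\<close> for \<open>i \<ge> 1\<close>.
\<close>

text \<open>Since \<open>\<bar>s\<bar> ^ i \<le> 1\<close>, the series is dominated termwise by
  \<open>c\<close> itself.\<close>

lemma summable_mult_power_of_nonneg:
  fixes c :: "nat \<Rightarrow> real"
  assumes "summable c" "\<And>i. 0 \<le> c i" "\<bar>s\<bar> \<le> 1"
  shows "summable (\<lambda>i. c i * s ^ i)"
  by (rule summable_comparison_test'[OF assms(1), where N = 0])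
    (use assms in \<open>auto simp: abs_mult power_abs power_le_one intro!: mult_left_le\<close>)

text \<open>Write \<open>s ^ X\<close> pointwise as the series of \<open>s ^ i\<close> times the
  indicator of the event \<open>X = i\<close>, which has a single nonzero term, and exchange
  expectation with summation. The exchange is justified by absolute convergence.\<close>

lemma (in prob_space) pgf_sums_expectation:
  fixes X :: "'a \<Rightarrow> nat" and s :: real
  assumes X: "random_variable (count_space UNIV) X" and s: "\<bar>s\<bar> \<le> 1"
  shows "(\<lambda>i. measure M {\<omega> \<in> space M. X \<omega> = i} * s ^ i) sums expectation (\<lambda>\<omega>. s ^ X \<omega>)"
proof -
  let ?A = "\<lambda>i. {\<omega> \<in> space M. X \<omega> = i}"
  let ?f = "\<lambda>i \<omega>. indicator (?A i) \<omega> * s ^ i :: real"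
  have A: "?A i \<in> events" for i
    using measurable_sets[OF X, of "{i}"] by (simp add: vimage_def Int_def conj_commute)
  have point: "(\<lambda>i. ?f i \<omega>) sums s ^ X \<omega>" "summable (\<lambda>i. norm (?f i \<omega>))"
    if "\<omega> \<in> space M" for \<omega>
  proof -
    have eq: "?f i \<omega> = (if i = X \<omega> then s ^ i else 0)" for i
      using that by auto
    show "(\<lambda>i. ?f i \<omega>) sums s ^ X \<omega>"
      unfolding eq by (rule sums_single)
    have "(\<lambda>i. norm (?f i \<omega>)) = (\<lambda>i. if i = X \<omega> then norm (s ^ i) else 0)"
      unfolding eq by auto
    then show "summable (\<lambda>i. norm (?f i \<omega>))"
      by (simp only: summable_single)
  qed
  \<comment> \<open>By countable additivity the probabilities of these disjoint events form a
    convergent series. It dominates the series of the integrals of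
    \<open>norm (?f i \<omega>)\<close>.\<close>
  have "disjoint_family ?A"
    by (auto simp: disjoint_family_on_def)
  then have "(\<lambda>i. measure M (?A i)) sums measure M (\<Union>i. ?A i)"
    using A by (intro finite_measure_UNION) auto
  then have "summable (\<lambda>i. measure M (?A i))"
    by (rule sums_summable)
  then have summ: "summable (\<lambda>i. measure M (?A i) * \<bar>s\<bar> ^ i)"
    using s by (intro summable_mult_power_of_nonneg) auto
  have int: "integrable M (?f i)" for i
    using A by (intro integrable_mult_left) (auto simp: emeasure_eq_measure)
  have norm: "(\<integral>\<omega>. norm (?f i \<omega>) \<partial>M) = measure M (?A i) * \<bar>s\<bar> ^ i" for i
    using A by (simp add: abs_mult power_abs)
  have "(\<lambda>i. integral\<^sup>L M (?f i)) sums (\<integral>\<omega>. (\<Sum>i. ?f i \<omega>) \<partial>M)"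
    using int summ point(2) by (intro sums_integral) (auto simp only: norm AE_I2)
  moreover have "(\<integral>\<omega>. (\<Sum>i. ?f i \<omega>) \<partial>M) = expectation (\<lambda>\<omega>. s ^ X \<omega>)"
    using point(1) by (intro Bochner_Integration.integral_cong) (auto simp: sums_iff)
  ultimately show ?thesis
    using A by simp
qed

lemma pgf_eq_expectation:
  fixes X :: "'a \<Rightarrow> nat" and s :: real
  assumes "prob_space M" "prob_space.random_variable M (count_space UNIV) X" "\<bar>s\<bar> \<le> 1"
  shows "prob_space.expectation M (\<lambda>\<omega>. s ^ X \<omega>) = pgf M X s"
  using prob_space.pgf_sums_expectation[OF assms] by (simp add: pgf_def sums_iff)

lemma pgf_1:
  assumes "prob_space M" "prob_space.random_variable M (count_space UNIV) X"
  shows "pgf M X 1 = 1"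
  using pgf_eq_expectation[OF assms, of 1] assms(1) by (simp add: prob_space.prob_space)

theorem theorem2p1:
  fixes M :: "'a measure" and X :: "'a \<Rightarrow> nat"
  assumes "prob_space M"
    and "prob_space.random_variable M (count_space UNIV) X"
  shows "stuttering_Poisson M X \<longleftrightarrow>
    (\<forall>s :: real. \<bar>s\<bar> \<le> 1 \<longrightarrow> 0 < pgf M X s) \<and>
    (\<exists>(r :: enat) (b :: nat \<Rightarrow> real) (lam :: real).
       1 \<le> r \<and>
       (\<forall>s :: real. \<bar>s\<bar> \<le> 1 \<longrightarrow>
          (\<lambda>i. if enat i \<le> r then b i * s ^ i else 0) sums ln (pgf M X s)) \<and>
       (\<forall>i. 1 \<le> i \<and> enat i \<le> r \<longrightarrow> 0 \<le> b i) \<and>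
       0 < lam \<and>
       (\<lambda>i. if 1 \<le> i \<and> enat i \<le> r then b i else 0) sums lam)"
  (is "_ \<longleftrightarrow> ?pos \<and> ?log")
proof
  assume "stuttering_Poisson M X"
  then obtain r lam \<alpha> where r: "1 \<le> r" and lam: "0 < lam"
    and \<alpha>: "\<forall>i. 1 \<le> i \<and> enat i \<le> r \<longrightarrow> 0 \<le> \<alpha> i"
    and sum1: "(\<lambda>i. if 1 \<le> i \<and> enat i \<le> r then \<alpha> i else 0) sums 1"
    and E: "\<forall>s::real. \<bar>s\<bar> \<le> 1 \<longrightarrow> prob_space.expectation M (\<lambda>\<omega>. s ^ X \<omega>) =
          exp (lam * (\<Sum>i. if 1 \<le> i \<and> enat i \<le> r then \<alpha> i * (s ^ i - 1) else 0))"
    unfolding stuttering_Poisson_def by blast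
  \<comment> \<open>Padding with zeros removes \<open>r\<close> from the series, and in particular
    makes \<open>c 0 = 0\<close>.\<close>
  define c where "c = (\<lambda>i. if 1 \<le> i \<and> enat i \<le> r then \<alpha> i else 0)"
  have c: "c sums 1" "\<And>i. 0 \<le> c i"
    using sum1 \<alpha> by (auto simp: c_def)
  have P: "pgf M X s = exp (lam * (\<Sum>i. c i * (s ^ i - 1)))" if "\<bar>s\<bar> \<le> 1" for s
  proof -
    have "(\<lambda>i. if 1 \<le> i \<and> enat i \<le> r then \<alpha> i * (s ^ i - 1) else 0) = (\<lambda>i. c i * (s ^ i - 1))"
      by (auto simp: c_def)
    then show ?thesis
      using that E pgf_eq_expectation[OF assms] by simp
  qed
  \<comment> \<open>As \<open>c\<close> sums to 1, the terms \<open>-1\<close> in the exponent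
    contribute \<open>- lam\<close> in total, and this becomes the constant coefficient.\<close>
  define b where "b = (\<lambda>i. if i = 0 then - lam else lam * \<alpha> i)"
  have "(\<lambda>i. if enat i \<le> r then b i * s ^ i else 0) sums ln (pgf M X s)" if s: "\<bar>s\<bar> \<le> 1" for s
  proof -
    have S: "(\<lambda>i. c i * s ^ i) sums (\<Sum>i. c i * s ^ i)"
      using c s by (intro summable_sums summable_mult_power_of_nonneg) (auto simp: sums_iff)
    then have "(\<lambda>i. c i * (s ^ i - 1)) sums ((\<Sum>i. c i * s ^ i) - 1)"
      using sums_diff[OF _ c(1)] by (simp add: algebra_simps)
    then have "(\<Sum>i. c i * (s ^ i - 1)) = (\<Sum>i. c i * s ^ i) - 1"
      by (rule sums_unique[symmetric])
    then have "ln (pgf M X s) = lam * (\<Sum>i. c i * s ^ i) + - lam"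
      by (simp add: P[OF s] right_diff_distrib)
    moreover have "(\<lambda>i. lam * (c i * s ^ i) + (if i = 0 then - lam else 0)) sums
        (lam * (\<Sum>i. c i * s ^ i) + - lam)"
      by (intro sums_add sums_mult S sums_single)
    \<comment> \<open>At \<open>i = 0\<close> the guard \<open>enat 0 \<le> r\<close> always holds,
      so the right side always contains \<open>b 0\<close>, while \<open>c 0 = 0\<close> leaves only
      \<open>- lam\<close> on the left.\<close>
    moreover have "(\<lambda>i. lam * (c i * s ^ i) + (if i = 0 then - lam else 0)) =
        (\<lambda>i. if enat i \<le> r then b i * s ^ i else 0)"
      by (auto simp: c_def b_def fun_eq_iff zero_enat_def[symmetric])
    ultimately show ?thesis
      by simp
  qed
  moreover have "(\<lambda>i. if 1 \<le> i \<and> enat i \<le> r then b i else 0) sums lam"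
  proof -
    have "(\<lambda>i. if 1 \<le> i \<and> enat i \<le> r then b i else 0) = (\<lambda>i. lam * c i)"
      by (auto simp: b_def c_def)
    then show ?thesis
      using sums_mult[OF c(1), of lam] by simp
  qed
  moreover have "\<forall>i. 1 \<le> i \<and> enat i \<le> r \<longrightarrow> 0 \<le> b i"
    using \<alpha> lam by (auto simp: b_def)
  ultimately have ?log
    using r lam by blast
  then show "?pos \<and> ?log"
    using P by simp
next
  assume "?pos \<and> ?log"
  then obtain r b lam where pos: ?pos
    and L: "\<forall>s::real. \<bar>s\<bar> \<le> 1 \<longrightarrow>
          (\<lambda>i. if enat i \<le> r then b i * s ^ i else 0) sums ln (pgf M X s)"
    and b: "\<forall>i. 1 \<le> i \<and> enat i \<le> r \<longrightarrow> 0 \<le> b i" and lam: "0 < lam"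
    and sum: "(\<lambda>i. if 1 \<le> i \<and> enat i \<le> r then b i else 0) sums lam"
    by blast
  define c where "c = (\<lambda>i. if 1 \<le> i \<and> enat i \<le> r then b i else 0)"
  have c: "c sums lam" "\<And>i. 0 \<le> c i" "c 0 = 0"
    using sum b by (auto simp: c_def)
  have split: "(\<lambda>i. if enat i \<le> r then b i * s ^ i else 0) =
      (\<lambda>i. c i * s ^ i + (if i = 0 then b 0 else 0))" for s :: real
    by (auto simp: c_def fun_eq_iff zero_enat_def[symmetric])
  \<comment> \<open>Evaluate the expansion at \<open>s = 1\<close>, where
    \<open>ln (pgf M X 1) = ln 1 = 0\<close>.\<close>
  have "(\<lambda>i. c i * 1 ^ i + (if i = 0 then b 0 else 0)) sums 0"
    using L[rule_format, of 1] by (simp only: split) (simp add: pgf_1[OF assms])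
  moreover have "(\<lambda>i. c i * 1 ^ i + (if i = 0 then b 0 else 0)) sums (lam + b 0)"
    using sums_add[OF c(1) sums_single[of 0 "\<lambda>_. b 0"]] by simp
  ultimately have b0: "b 0 = - lam"
    using sums_unique2 by fastforce
  \<comment> \<open>Padding with zeros and taking \<open>r = \<infinity>\<close> makes the condition \<open>\<alpha> r \<noteq> 0\<close> vacuous.\<close>
  define \<alpha> where "\<alpha> = (\<lambda>i. c i / lam)"
  have \<alpha>_sums: "\<alpha> sums 1"
    using sums_divide[OF c(1), of lam] lam by (simp add: \<alpha>_def)
  \<comment> \<open>A single term of a nonnegative series is at most its sum; after division by
    \<open>lam\<close> this gives \<open>\<alpha> i \<le> 1\<close>.\<close>
  have "c i \<le> lam" for i
    using sum_le_suminf[of c "{i}"] c by (auto simp: sums_iff)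
  then have \<alpha>_bounds: "0 \<le> \<alpha> i \<and> \<alpha> i \<le> 1" for i
    using c(2) lam by (simp add: \<alpha>_def)
  have drop0: "(if 1 \<le> i then \<alpha> i else 0) = \<alpha> i"
    "(if 1 \<le> i then \<alpha> i * x else 0) = \<alpha> i * x" for i x
    using c(3) by (auto simp: \<alpha>_def Suc_le_eq)
  have "prob_space.expectation M (\<lambda>\<omega>. s ^ X \<omega>) = exp (lam * (\<Sum>i. \<alpha> i * (s ^ i - 1)))"
    if s: "\<bar>s\<bar> \<le> 1" for s
  proof -
    have S: "(\<lambda>i. c i * s ^ i) sums (\<Sum>i. c i * s ^ i)"
      using c s by (intro summable_sums summable_mult_power_of_nonneg) (auto simp: sums_iff)
    have "ln (pgf M X s) = (\<Sum>i. c i * s ^ i) + b 0"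
      using L s sums_add[OF S sums_single[of 0 "\<lambda>_. b 0"]] by (simp add: split sums_iff)
    moreover have "(\<lambda>i. \<alpha> i * (s ^ i - 1)) sums (((\<Sum>i. c i * s ^ i) - lam) / lam)"
      using sums_divide[OF sums_diff[OF S c(1)], of lam]
      by (simp add: \<alpha>_def algebra_simps diff_divide_distrib)
    ultimately have "ln (pgf M X s) = lam * (\<Sum>i. \<alpha> i * (s ^ i - 1))"
      using lam b0 by (simp add: sums_iff)
    \<comment> \<open>Exponentiating recovers \<open>pgf M X s\<close> because \<open>pos\<close>
      makes it positive: \<open>ln\<close> is total in HOL, and \<open>exp (ln x) = x\<close> holds
      only for \<open>x > 0\<close>.\<close>
    then show ?thesis
      using pos s pgf_eq_expectation[OF assms s] by (metis exp_ln)
  qed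
  then show "stuttering_Poisson M X"
    unfolding stuttering_Poisson_def
    using lam \<alpha>_sums \<alpha>_bounds
    by (intro exI[of _ \<infinity>] exI[of _ lam] exI[of _ \<alpha>]) (simp add: drop0[simplified])
qed

end
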